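(* Let $\mathcal{W}$ be either of the wavelet transforms $\mathcal{W}^{(1)}_J$ or $\mathcal{W}^{(2)}_J$, and let $\boldsymbol{\mu}=\mathbf{u}_0$. Then for every path $\mathbf{p}=(j_1,\dots,j_m)$ of nonnegative integers ($m\ge0$) and every $\mathbf{x}\in\mathbf{L}^2(\mathbf{M})$, $$\lim_{J\to\infty}\big\|\mathbf{S}_J[\mathbf{p}]\mathbf{x}-(\overline{\mathbf{S}}_{\mathbf{u}_0}[\mathbf{p}]\mathbf{x})\,\mathbf{u}_0\big\|_{\mathbf{M}}=0,$$ where $J$ is assumed large enough ($J\ge\max_i j_i$) that $\mathbf{S}_J[\mathbf{p}]$ is well-defined.
   Context: Let $G=(V,E,W)$ be a weighted, connected (undirected) graph with vertices $\{0,\dots,n-1\}$, weighted adjacency matrix $\mathbf{A}$, weighted degree vector $\mathbf{d}$, and $\mathbf{D}=\mathrm{diag}(\mathbf{d})$. Let $\mathbf{N}=\mathbf{I}-\mathbf{D}^{-1/2}\mathbf{A}\mathbf{D}^{-1/2}$ have eigenvalues $0=\omega_0<\omega_1\le\dots\le\omega_{n-1}\le 2$ and orthonormal eigenbasis $\mathbf{v}_0,\dots,\mathbf{v}_{n-1}$ of $\mathbb{R}^n$, $\mathbf{N}\mathbf{v}_i=\omega_i\mathbf{v}_i$, with $\mathbf{v}_0=\mathbf{d}^{1/2}/\|\mathbf{d}^{1/2}\|_2$ (square root componentwise), and let $\mathbf{V}$ be the orthogonal matrix with columns $\mathbf{v}_i$. Let $g:[0,2]\to[0,1]$ be a monotonically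 decreasing function with $g(0)=1$, $g(2)=0$; put $\lambda_i=g(\omega_i)$, so $1=\lambda_0>\lambda_1\ge\dots\ge\lambda_{n-1}\ge 0$, $\Lambda=\mathrm{diag}(\lambda_0,\dots,\lambda_{n-1})$ and $\mathbf{T}=\mathbf{V}\Lambda\mathbf{V}^T$. Let $\mathbf{M}$ be an invertible real $n\times n$ matrix, $\mathbf{K}=\mathbf{M}^{-1}\mathbf{T}\mathbf{M}$, and $\mathbf{u}_i=\mathbf{M}^{-1}\mathbf{v}_i$. $\mathbf{L}^2(\mathbf{M})$ is $\mathbb{R}^n$ with inner product $\langle\mathbf{x},\mathbf{y}\rangle_{\mathbf{M}}=\langle\mathbf{M}\mathbf{x},\mathbf{M}\mathbf{y}\rangle_2$ and norm $\|\mathbf{x}\|_{\mathbf{M}}=\|\mathbf{M}\mathbf{x}\|_2$. For $J\ge0$ let $p_0(t)=1-t$, $p_j(t)=t^{2^{j-1}}-t^{2^j}$ for $1\le j\le J$, $p_{J+1}(t)=t^{2^J}$, and $q_j=p_j^{1/2}$ on $[0,1]$. For a function $f$ on $[0,1]$, $f(\mathbf{K})=\mathbf{M}^{-1}\mathbf{V}f(\Lambda)\mathbf{V}^T\mathbf{M}$ with $f$ applied to the diagonal entries of $\Lambda$. $\mathcal{W}^{(1)}_J$ consists of $\Psi_j=q_j(\mathbf{K})$ ($0\le j\le J$) and $\Phi=q_{J+1}(\mathbf{K})$; $\mathcal{W}^{(2)}_J$ consists of $\Psi_j=p_j(\mathbf{K})$ ($0\le j\le J$) and $\Phi=p_{J+1}(\mathbf{K})$.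 Let $M$ denote the entrywise absolute value on $\mathbb{R}^n$. For a path $\mathbf{p}=(j_1,\dots,j_m)$ set $\mathbf{U}[\mathbf{p}]\mathbf{x}=M\Psi_{j_m}\cdots M\Psi_{j_1}\mathbf{x}$ (and $\mathbf{U}[\mathbf{p}]\mathbf{x}=\mathbf{x}$ for the empty path, $m=0$). The windowed coefficients are $\mathbf{S}_J[\mathbf{p}]\mathbf{x}=\Phi\,\mathbf{U}[\mathbf{p}]\mathbf{x}$, and the non-windowed coefficients with weight vector $\boldsymbol{\mu}$ are $\overline{\mathbf{S}}_{\boldsymbol{\mu}}[\mathbf{p}]\mathbf{x}=\langle\boldsymbol{\mu},\mathbf{U}[\mathbf{p}]\mathbf{x}\rangle_{\mathbf{M}}$. *)

theory Defs
  imports Complex_Main "Jordan_Normal_Form.Gauss_Jordan_Elimination" "Jordan_Normal_Form.Char_Poly"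
begin

(* Vertex set {0..<n}; an undirected edge {i, j} is represented by both (i, j) and (j, i).
   Self-loops are permitted.  W is only relevant on E. *)
definition weighted_connected_graph :: "nat \<Rightarrow> (nat \<times> nat) set \<Rightarrow> (nat \<Rightarrow> nat \<Rightarrow> real) \<Rightarrow> bool" where
  "weighted_connected_graph n E W \<longleftrightarrow>
     0 < n \<and> E \<subseteq> {0..<n} \<times> {0..<n} \<and> sym E \<and>
     (\<forall>(i, j) \<in> E. 0 < W i j \<and> W i j = W j i) \<and>
     (\<forall>i<n. \<forall>j<n. (i, j) \<in> E\<^sup>*)"

definition adjacency :: "nat \<Rightarrow> (nat \<times> nat) set \<Rightarrow> (nat \<Rightarrow> nat \<Rightarrow> real) \<Rightarrow> real mat" where
  "adjacency n E W = mat n n (\<lambda>(i, j). if (i, j) \<in> E then W i j else 0)"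

definition degrees :: "nat \<Rightarrow> (nat \<times> nat) set \<Rightarrow> (nat \<Rightarrow> nat \<Rightarrow> real) \<Rightarrow> real vec" where
  "degrees n E W = vec n (\<lambda>i. \<Sum>j<n. adjacency n E W $$ (i, j))"

definition normalized_laplacian :: "nat \<Rightarrow> (nat \<times> nat) set \<Rightarrow> (nat \<Rightarrow> nat \<Rightarrow> real) \<Rightarrow> real mat" where
  "normalized_laplacian n E W =
     (let R = mat_diag n (\<lambda>i. 1 / sqrt (degrees n E W $ i))
      in 1\<^sub>m n - R * adjacency n E W * R)"

definition norm2 :: "real vec \<Rightarrow> real" where
  "norm2 x = sqrt (x \<bullet> x)"

(* Only used for invertible M, where mat_inverse M is Some of the two-sided inverse. *)
definition mat_inv :: "real mat \<Rightarrow> real mat" where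
  "mat_inv M = the (mat_inverse M)"

definition inner_M :: "real mat \<Rightarrow> real vec \<Rightarrow> real vec \<Rightarrow> real" where
  "inner_M M x y = (M *\<^sub>v x) \<bullet> (M *\<^sub>v y)"

definition norm_M :: "real mat \<Rightarrow> real vec \<Rightarrow> real" where
  "norm_M M x = norm2 (M *\<^sub>v x)"

(* f(K) = M^{-1} V f(Lambda) V^T M, where V has columns v 0, ..., v (n - 1) and
   Lambda = diag (lam 0, ..., lam (n - 1)). *)
definition fun_of_K ::
  "nat \<Rightarrow> (nat \<Rightarrow> real vec) \<Rightarrow> (nat \<Rightarrow> real) \<Rightarrow> real mat \<Rightarrow> (real \<Rightarrow> real) \<Rightarrow> real mat" where
  "fun_of_K n v lam M f =
     (let V = mat_of_cols n (map v [0..<n])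
      in mat_inv M * V * mat_diag n (\<lambda>i. f (lam i)) * V\<^sup>T * M)"

(* band_poly j is p_j for 0 \<le> j \<le> J, which does not depend on J; low_poly J is p_{J+1}. *)
definition band_poly :: "nat \<Rightarrow> real \<Rightarrow> real" where
  "band_poly j t = (if j = 0 then 1 - t else t ^ (2 ^ (j - 1)) - t ^ (2 ^ j))"

definition low_poly :: "nat \<Rightarrow> real \<Rightarrow> real" where
  "low_poly J t = t ^ (2 ^ J)"

datatype wavelet_transform = W1 | W2

fun band_filter :: "wavelet_transform \<Rightarrow> nat \<Rightarrow> real \<Rightarrow> real" where
  "band_filter W1 j t = sqrt (band_poly j t)"
| "band_filter W2 j t = band_poly j t"

fun low_filter :: "wavelet_transform \<Rightarrow> nat \<Rightarrow> real \<Rightarrow> real" where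
  "low_filter W1 J t = sqrt (low_poly J t)"
| "low_filter W2 J t = low_poly J t"

definition Psi ::
  "wavelet_transform \<Rightarrow> nat \<Rightarrow> (nat \<Rightarrow> real vec) \<Rightarrow> (nat \<Rightarrow> real) \<Rightarrow> real mat \<Rightarrow> nat \<Rightarrow> real mat" where
  "Psi w n v lam M j = fun_of_K n v lam M (band_filter w j)"

definition Phi ::
  "wavelet_transform \<Rightarrow> nat \<Rightarrow> (nat \<Rightarrow> real vec) \<Rightarrow> (nat \<Rightarrow> real) \<Rightarrow> real mat \<Rightarrow> nat \<Rightarrow> real mat" where
  "Phi w n v lam M J = fun_of_K n v lam M (low_filter w J)"

(* The path (j_1, ..., j_m) is the list [j_1, ..., j_m]; Psi_{j_1} is applied first. *)
fun scatter_U ::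
  "wavelet_transform \<Rightarrow> nat \<Rightarrow> (nat \<Rightarrow> real vec) \<Rightarrow> (nat \<Rightarrow> real) \<Rightarrow> real mat \<Rightarrow> nat list
     \<Rightarrow> real vec \<Rightarrow> real vec" where
  "scatter_U w n v lam M [] x = x"
| "scatter_U w n v lam M (j # p) x =
     scatter_U w n v lam M p (map_vec abs (Psi w n v lam M j *\<^sub>v x))"

(* Meaningful as a coefficient of the transform of scale J only when all entries of p are
   at most J; otherwise p contains indices that are not wavelets of that transform. *)
definition windowed_S ::
  "wavelet_transform \<Rightarrow> nat \<Rightarrow> (nat \<Rightarrow> real vec) \<Rightarrow> (nat \<Rightarrow> real) \<Rightarrow> real mat \<Rightarrow> nat \<Rightarrow> nat list
     \<Rightarrow> real vec \<Rightarrow> real vec" where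
  "windowed_S w n v lam M J p x = Phi w n v lam M J *\<^sub>v scatter_U w n v lam M p x"

definition nonwindowed_S ::
  "wavelet_transform \<Rightarrow> nat \<Rightarrow> (nat \<Rightarrow> real vec) \<Rightarrow> (nat \<Rightarrow> real) \<Rightarrow> real mat \<Rightarrow> real vec \<Rightarrow> nat list
     \<Rightarrow> real vec \<Rightarrow> real" where
  "nonwindowed_S w n v lam M mu p x = inner_M M mu (scatter_U w n v lam M p x)"

end

theory Submission
  imports Defs
begin

(* After conjugation by M, f(K) becomes the sum over k of f(lambda_k) times the orthogonal
   projection onto v_k.  The low pass filter is 1 at lambda_0 = 1 and tends to 0 on [0,1), so only
   the v_0 component of U[p]x survives, provided that lambda_k < 1 for k > 0.  The latter is where
   connectedness enters: the Dirichlet form of a kernel vector of the normalized Laplacian vanishes,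
   hence D^(-1/2) times that vector is constant along every path. *)

section \<open>The spectrum of the normalized Laplacian\<close>

text \<open>Expanding the square gives two diagonal sums, which symmetry of \<open>a\<close> makes
  equal, and a cross term. Keeping the sign \<open>s\<close> free covers both quadratic forms used
  later: \<open>s = -1\<close> belongs to the normalized Laplacian, \<open>s = 1\<close> to twice
  the identity minus it.\<close>

lemma dirichlet_form:
  fixes a :: "nat \<Rightarrow> nat \<Rightarrow> real" and z :: "nat \<Rightarrow> real" and s :: real
  assumes sym: "\<And>i j. i < n \<Longrightarrow> j < n \<Longrightarrow> a i j = a j i" and s: "s\<^sup>2 = 1"
  shows "(\<Sum>i<n. \<Sum>j<n. a i j * (z i + s * z j)\<^sup>2) =
    2 * (\<Sum>i<n. (\<Sum>j<n. a i j) * (z i)\<^sup>2) + 2 * s * (\<Sum>i<n. \<Sum>j<n. a i j * z i * z j)"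
proof -
  have "(\<Sum>i<n. \<Sum>j<n. a i j * (z j)\<^sup>2) = (\<Sum>j<n. \<Sum>i<n. a i j * (z j)\<^sup>2)"
    by (rule sum.swap)
  also have "\<dots> = (\<Sum>i<n. \<Sum>j<n. a i j * (z i)\<^sup>2)"
    by (intro sum.cong refl) (simp add: sym)
  finally have swap: "(\<Sum>i<n. \<Sum>j<n. a i j * (z j)\<^sup>2) = (\<Sum>i<n. \<Sum>j<n. a i j * (z i)\<^sup>2)" .
  have "a i j * (z i + s * z j)\<^sup>2 =
      a i j * (z i)\<^sup>2 + a i j * (z j)\<^sup>2 + 2 * s * (a i j * z i * z j)" for i j
  proof -
    have "(z i + s * z j)\<^sup>2 = (z i)\<^sup>2 + s\<^sup>2 * (z j)\<^sup>2 + 2 * s * z i * z j"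
      by (simp add: power2_eq_square algebra_simps)
    then show ?thesis
      by (simp add: s algebra_simps)
  qed
  then show ?thesis
    by (simp add: sum.distrib swap sum_distrib_left[symmetric] sum_distrib_right[symmetric])
qed

section \<open>Weights and degrees of a connected graph\<close>

lemma adjacency_sym:
  assumes "weighted_connected_graph n E W" "i < n" "j < n"
  shows "adjacency n E W $$ (i, j) = adjacency n E W $$ (j, i)"
  using assms by (auto simp: weighted_connected_graph_def adjacency_def dest: symD)

lemma adjacency_nonneg:
  assumes "weighted_connected_graph n E W" "i < n" "j < n"
  shows "0 \<le> adjacency n E W $$ (i, j)"
  using assms by (auto simp: weighted_connected_graph_def adjacency_def intro: less_imp_le)

lemma adjacency_pos:
  assumes "weighted_connected_graph n E W" "(i, j) \<in> E"
  shows "i < n" "j < n" "0 < adjacency n E W $$ (i, j)"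
proof -
  show "i < n" "j < n"
    using assms by (auto simp: weighted_connected_graph_def)
  then show "0 < adjacency n E W $$ (i, j)"
    using assms by (auto simp: weighted_connected_graph_def adjacency_def)
qed

text \<open>The only connected graph with a vertex of degree zero is the single vertex without a
  loop.\<close>

lemma degrees_pos:
  assumes graph: "weighted_connected_graph n E W" and i: "i < n"
    and nz: "\<exists>k<n. degrees n E W $ k \<noteq> 0"
  shows "0 < degrees n E W $ i"
proof -
  have "\<exists>j. (i, j) \<in> E"
  proof (rule ccontr)
    assume no: "\<nexists>j. (i, j) \<in> E"
    \<comment> \<open>With no edge leaving \<open>i\<close>, the only vertex reachable from
      \<open>i\<close> is \<open>i\<close> itself, so connectedness forces the witness of
      \<open>nz\<close> to be \<open>i\<close>.\<close>
    have "k = i" if "k < n" for k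
    proof -
      have "(i, k) \<in> E\<^sup>*"
        using graph i that by (auto simp: weighted_connected_graph_def)
      then show ?thesis
        using no by (auto elim: converse_rtranclE)
    qed
    with nz have "degrees n E W $ i \<noteq> 0"
      by auto
    moreover have "degrees n E W $ i = 0"
      using i no by (auto simp: degrees_def adjacency_def intro!: sum.neutral)
    ultimately show False
      by simp
  qed
  then obtain j where j: "(i, j) \<in> E" ..
  note adj = adjacency_pos[OF graph j]
  have "0 < (\<Sum>j<n. adjacency n E W $$ (i, j))"
    using adj by (intro sum_pos2[of _ j]) (auto intro: adjacency_nonneg[OF graph])
  then show ?thesis
    using i by (simp add: degrees_def)
qed

section \<open>The normalized Laplacian as a quadratic form\<close>

lemma normalized_laplacian_mult_vec:
  fixes E W n
  assumes y: "y \<in> carrier_vec n" and i: "i < n"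
  defines "r \<equiv> \<lambda>i. 1 / sqrt (degrees n E W $ i)"
  shows "(normalized_laplacian n E W *\<^sub>v y) $ i =
    y $ i - r i * (\<Sum>j<n. adjacency n E W $$ (i, j) * (r j * y $ j))"
proof -
  have A: "adjacency n E W \<in> carrier_mat n n"
    by (simp add: adjacency_def)
  have RAR: "mat_diag n r * adjacency n E W * mat_diag n r =
      mat n n (\<lambda>(i, j). r i * adjacency n E W $$ (i, j) * r j)"
    using A by (subst mat_diag_mult_left[OF A], subst mat_diag_mult_right[of _ n])
      auto
  have "(normalized_laplacian n E W *\<^sub>v y) $ i =
      (\<Sum>j<n. ((if i = j then 1 else 0) - r i * adjacency n E W $$ (i, j) * r j) * y $ j)"
    using y i unfolding normalized_laplacian_def Let_def r_def[symmetric] RAR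
    by (auto simp: scalar_prod_def atLeast0LessThan intro!: sum.cong)
  also have "\<dots> = (\<Sum>j<n. if i = j then y $ j else 0) -
      (\<Sum>j<n. r i * (adjacency n E W $$ (i, j) * (r j * y $ j)))"
    unfolding sum_subtractf[symmetric] by (intro sum.cong) (auto simp: algebra_simps)
  finally show ?thesis
    using i by (simp add: sum_distrib_left)
qed

text \<open>For a unit eigenvector the Rayleigh quotient is the eigenvalue \<open>c\<close>. Written
  in the rescaled coordinates \<open>z i = y $ i / sqrt (d i)\<close>, it determines the cross term
  of the Dirichlet form, while the diagonal part is the squared norm of \<open>y\<close>.\<close>

lemma eigenvalue_dirichlet_form:
  fixes E W n
  defines "a \<equiv> \<lambda>i j. adjacency n E W $$ (i, j)"
    and "d \<equiv> \<lambda>i. degrees n E W $ i"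
  assumes graph: "weighted_connected_graph n E W"
    and dpos: "\<And>i. i < n \<Longrightarrow> 0 < d i"
    and ev: "eigenvector (normalized_laplacian n E W) y c" and unit: "y \<bullet> y = 1"
  shows "(\<Sum>i<n. \<Sum>j<n. a i j * (y $ i / sqrt (d i) - y $ j / sqrt (d j))\<^sup>2) = 2 * c" (is ?minus)
    and "(\<Sum>i<n. \<Sum>j<n. a i j * (y $ i / sqrt (d i) + y $ j / sqrt (d j))\<^sup>2) = 4 - 2 * c" (is ?plus)
proof -
  define z where "z = (\<lambda>i. y $ i / sqrt (d i))"
  have "dim_row (normalized_laplacian n E W) = n"
    by (simp add: normalized_laplacian_def Let_def mat_diag_def)
  with ev have y: "y \<in> carrier_vec n" and Ny: "normalized_laplacian n E W *\<^sub>v y = c \<cdot>\<^sub>v y"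
    by (auto simp: eigenvector_def)
  \<comment> \<open>The row sums of \<open>a\<close> are the degrees, and they cancel the squared
    denominators in \<open>z\<close>.\<close>
  have sq: "(\<Sum>i<n. (\<Sum>j<n. a i j) * (z i)\<^sup>2) = 1"
  proof -
    have "(\<Sum>i<n. (\<Sum>j<n. a i j) * (z i)\<^sup>2) = (\<Sum>i<n. y $ i * y $ i)"
    proof (intro sum.cong refl)
      fix i assume "i \<in> {..<n}"
      then have i: "i < n" by simp
      have "(\<Sum>j<n. a i j) = d i"
        using i by (simp add: a_def d_def degrees_def)
      then show "(\<Sum>j<n. a i j) * (z i)\<^sup>2 = y $ i * y $ i"
        using dpos[OF i] by (simp add: z_def power_divide power2_eq_square)
    qed
    also have "\<dots> = 1"
      using y unit by (simp add: scalar_prod_def atLeast0LessThan)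
    finally show ?thesis .
  qed
  have "c = y \<bullet> (c \<cdot>\<^sub>v y)"
    using y unit by simp
  also have "\<dots> = (\<Sum>i<n. y $ i * (normalized_laplacian n E W *\<^sub>v y) $ i)"
    using y by (auto simp: Ny scalar_prod_def atLeast0LessThan)
  also have "\<dots> = (\<Sum>i<n. y $ i * y $ i - (\<Sum>j<n. a i j * z i * z j))"
    using y by (intro sum.cong refl)
      (simp add: normalized_laplacian_mult_vec a_def z_def d_def sum_distrib_left algebra_simps)
  also have "\<dots> = 1 - (\<Sum>i<n. \<Sum>j<n. a i j * z i * z j)"
    using y unit by (simp add: sum_subtractf scalar_prod_def atLeast0LessThan)
  finally have cross: "(\<Sum>i<n. \<Sum>j<n. a i j * z i * z j) = 1 - c"
    by simp
  have sym: "a i j = a j i" if "i < n" "j < n" for i j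
    using adjacency_sym[OF graph that] by (simp add: a_def)
  show ?minus
    using dirichlet_form[of n a "-1" z, OF sym] sq cross unfolding z_def by simp
  show ?plus
    using dirichlet_form[of n a 1 z, OF sym] sq cross unfolding z_def by simp
qed

text \<open>Both Dirichlet forms are sums of nonnegative terms: the one with differences bounds
  \<open>c\<close> from below, the one with sums bounds it from above.\<close>

lemma normalized_laplacian_eigenvalue_bounds:
  assumes graph: "weighted_connected_graph n E W"
    and dpos: "\<And>i. i < n \<Longrightarrow> 0 < degrees n E W $ i"
    and ev: "eigenvector (normalized_laplacian n E W) y c" and unit: "y \<bullet> y = 1"
  shows "0 \<le> c" "c \<le> 2"
proof -
  note form = eigenvalue_dirichlet_form[OF graph dpos ev unit]
  have "0 \<le> 2 * c"
    by (subst form(1)[symmetric])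
      (auto intro!: sum_nonneg mult_nonneg_nonneg adjacency_nonneg[OF graph])
  moreover have "0 \<le> 4 - 2 * c"
    by (subst form(2)[symmetric])
      (auto intro!: sum_nonneg mult_nonneg_nonneg adjacency_nonneg[OF graph])
  ultimately show "0 \<le> c" "c \<le> 2"
    by auto
qed

text \<open>This gives simplicity of the eigenvalue 0: every unit kernel vector is proportional to
  the square roots of the degrees, hence to \<open>v 0\<close>. The factor \<open>b\<close> is the
  common value of \<open>z\<close>, read off at vertex 0.\<close>

lemma normalized_laplacian_kernel:
  assumes graph: "weighted_connected_graph n E W"
    and dpos: "\<And>i. i < n \<Longrightarrow> 0 < degrees n E W $ i"
    and ev: "eigenvector (normalized_laplacian n E W) y 0" and unit: "y \<bullet> y = 1"
  obtains b where "\<And>i. i < n \<Longrightarrow> y $ i = b * sqrt (degrees n E W $ i)"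
proof -
  define z where "z = (\<lambda>i. y $ i / sqrt (degrees n E W $ i))"
  have nonneg: "0 \<le> adjacency n E W $$ (i, j) * (z i - z j)\<^sup>2" if "i < n" "j < n" for i j
    using adjacency_nonneg[OF graph that] by simp
  have total: "(\<Sum>i<n. \<Sum>j<n. adjacency n E W $$ (i, j) * (z i - z j)\<^sup>2) = 0"
    using eigenvalue_dirichlet_form(1)[OF graph dpos ev unit] by (simp add: z_def)
  have edge: "z i = z j" if e: "(i, j) \<in> E" for i j
  proof -
    note adj = adjacency_pos[OF graph e]
    \<comment> \<open>A vanishing sum of nonnegative terms has only zero terms. This is applied
      first to the outer sum, then to the inner one, to isolate a single edge.\<close>
    have "(\<Sum>j<n. adjacency n E W $$ (i, j) * (z i - z j)\<^sup>2) = 0"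
      using total adj(1) by (subst (asm) sum_nonneg_eq_0_iff) (auto intro!: sum_nonneg nonneg)
    then have "adjacency n E W $$ (i, j) * (z i - z j)\<^sup>2 = 0"
      using adj(1,2) by (subst (asm) sum_nonneg_eq_0_iff) (auto intro!: nonneg)
    with adj(3) show ?thesis by simp
  qed
  have path: "z i = z j" if "(i, j) \<in> E\<^sup>*" for i j
    using that by induction (auto dest: edge)
  show thesis
  proof
    fix i assume i: "i < n"
    then have "z i = z 0"
      using graph by (intro path) (auto simp: weighted_connected_graph_def)
    then show "y $ i = z 0 * sqrt (degrees n E W $ i)"
      using dpos[OF i] by (simp add: z_def field_simps)
  qed
qed

section \<open>Spectral filters\<close>

text \<open>\<open>mat_inverse\<close> can fail only on matrices that are not units of the matrix
  ring, so invertibility has to be turned into membership in \<open>Units\<close>.\<close>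

lemma mat_inv_inverse:
  assumes "M \<in> carrier_mat n n" "invertible_mat M"
  shows "mat_inv M \<in> carrier_mat n n" "M * mat_inv M = 1\<^sub>m n"
proof -
  from assms obtain B where B: "M * B = 1\<^sub>m n" "B * M = 1\<^sub>m (dim_row B)"
    by (auto simp: invertible_mat_def inverts_mat_def)
  \<comment> \<open>Invertibility does not state the dimensions of \<open>B\<close>; they follow
    from comparing the column counts of the two products with those of the identities.\<close>
  then have "dim_col B = n" "dim_row B = n"
    using assms(1)
    by (metis index_mult_mat(3) index_one_mat(3),
        metis carrier_matD(2) index_mult_mat(3) index_one_mat(3))
  then have "M \<in> Units (ring_mat TYPE(real) n undefined)"
    using assms(1) B by (auto simp: Units_def ring_mat_def)
  then obtain C where "mat_inverse M = Some C"
    using mat_inverse(1)[OF assms(1), of undefined] by (cases "mat_inverse M") auto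
  with mat_inverse(2)[OF assms(1) this]
  show "mat_inv M \<in> carrier_mat n n" "M * mat_inv M = 1\<^sub>m n"
    by (auto simp: mat_inv_def)
qed

lemma fun_of_K_carrier:
  assumes "M \<in> carrier_mat n n" "invertible_mat M"
  shows "fun_of_K n v lam M f \<in> carrier_mat n n"
proof -
  have V: "mat_of_cols n (map v [0..<n]) \<in> carrier_mat n n"
    by (simp add: mat_of_cols_def)
  then show ?thesis
    unfolding fun_of_K_def Let_def
    by (intro mult_carrier_mat[of _ n n] mat_inv_inverse[OF assms] assms mat_diag_dim)
      simp_all
qed

text \<open>The outer \<open>M\<close> cancels \<open>mat_inv M\<close>. Of the remaining factors,
  the transpose of \<open>V\<close> takes inner products with the \<open>v k\<close>, the diagonal
  matrix scales them, and \<open>V\<close> recombines the columns.\<close>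

lemma M_fun_of_K_mult_vec:
  assumes M: "M \<in> carrier_mat n n" "invertible_mat M"
    and y: "y \<in> carrier_vec n" and v: "\<And>k. k < n \<Longrightarrow> v k \<in> carrier_vec n" and i: "i < n"
  shows "(M *\<^sub>v (fun_of_K n v lam M f *\<^sub>v y)) $ i =
    (\<Sum>k<n. f (lam k) * (v k \<bullet> (M *\<^sub>v y)) * v k $ i)"
proof -
  note inv = mat_inv_inverse[OF M]
  define V where "V = mat_of_cols n (map v [0..<n])"
  define F where "F = mat_diag n (\<lambda>k. f (lam k))"
  have V: "V \<in> carrier_mat n n" and F: "F \<in> carrier_mat n n" and VT: "V\<^sup>T \<in> carrier_mat n n"
    by (auto simp: V_def F_def mat_of_cols_def)
  define z where "z = M *\<^sub>v y"
  have z: "z \<in> carrier_vec n"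
    using M(1) y by (simp add: z_def mult_mat_vec_carrier[of _ n n])
  have "fun_of_K n v lam M f *\<^sub>v y = mat_inv M *\<^sub>v (V *\<^sub>v (F *\<^sub>v (V\<^sup>T *\<^sub>v z)))"
    unfolding fun_of_K_def Let_def V_def[symmetric] F_def[symmetric] z_def
    using M(1) inv(1) V F VT y
    by (simp add: assoc_mult_mat_vec[of _ n n _ n] mult_carrier_mat[of _ n n] mult_mat_vec_carrier[of _ n n])
  then have "M *\<^sub>v (fun_of_K n v lam M f *\<^sub>v y) = (M * mat_inv M) *\<^sub>v (V *\<^sub>v (F *\<^sub>v (V\<^sup>T *\<^sub>v z)))"
    using M(1) inv(1) V F VT z
    by (simp add: assoc_mult_mat_vec[of _ n n _ n] mult_mat_vec_carrier[of _ n n])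
  also have "\<dots> = V *\<^sub>v (F *\<^sub>v (V\<^sup>T *\<^sub>v z))"
    using inv V F VT z by (simp add: mult_mat_vec_carrier[of _ n n])
  also have "V\<^sup>T *\<^sub>v z = vec n (\<lambda>k. v k \<bullet> z)"
    using v by (intro eq_vecI) (auto simp: V_def)
  also have "F *\<^sub>v \<dots> = vec n (\<lambda>k. f (lam k) * (v k \<bullet> z))"
  proof (rule eq_vecI, goal_cases)
    case (1 k)
    then show ?case
      by (simp add: F_def mat_diag_def scalar_prod_def if_distrib[of "\<lambda>t. t * _"] cong: if_cong)
  qed (simp add: F_def mat_diag_def)
  finally show ?thesis
    using i by (simp add: V_def scalar_prod_def mat_of_cols_def z_def atLeast0LessThan mult.commute)
qed

section \<open>Scattering coefficients and their limit\<close>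

lemma scatter_U_carrier:
  assumes "M \<in> carrier_mat n n" "invertible_mat M" "x \<in> carrier_vec n"
  shows "scatter_U w n v lam M p x \<in> carrier_vec n"
  using assms(3)
proof (induction p arbitrary: x)
  case (Cons j p)
  have "Psi w n v lam M j *\<^sub>v x \<in> carrier_vec n"
    unfolding Psi_def using assms(1,2) Cons.prems
    by (intro mult_mat_vec_carrier[of _ n n] fun_of_K_carrier)
  then show ?case
    by (simp add: Cons.IH)
qed simp

text \<open>The values \<open>t ^ (2 ^ J)\<close> form a subsequence of the powers of
  \<open>t\<close>; for \<open>W1\<close> continuity of the square root at 0 finishes the
  argument.\<close>

lemma low_filter_tendsto_0:
  assumes "0 \<le> t" "t < 1"
  shows "(\<lambda>J. low_filter w J t) \<longlonglongrightarrow> 0"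
proof -
  have "filterlim (\<lambda>J. 2 ^ J :: nat) at_top sequentially"
    by (rule filterlim_subseq) (simp add: strict_mono_def)
  then have lim: "(\<lambda>J. low_poly J t) \<longlonglongrightarrow> 0"
    unfolding low_poly_def using LIMSEQ_realpow_zero[OF assms] filterlim_compose by blast
  show ?thesis
    using lim tendsto_real_sqrt[OF lim] by (cases w) simp_all
qed

theorem proposition3p1:
  fixes n :: nat and E :: "(nat \<times> nat) set" and W :: "nat \<Rightarrow> nat \<Rightarrow> real"
    and \<omega> :: "nat \<Rightarrow> real" and v :: "nat \<Rightarrow> real vec" and g :: "real \<Rightarrow> real"
    and lam :: "nat \<Rightarrow> real" and M :: "real mat" and u0 :: "real vec"
    and w :: wavelet_transform and p :: "nat list" and x :: "real vec"
  assumes graph: "weighted_connected_graph n E W"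
    and eigen: "\<And>i. i < n \<Longrightarrow> eigenvector (normalized_laplacian n E W) (v i) (\<omega> i)"
    and eigenvalues_sorted: "\<And>i j. i \<le> j \<Longrightarrow> j < n \<Longrightarrow> \<omega> i \<le> \<omega> j"
    and orthonormal: "\<And>i j. i < n \<Longrightarrow> j < n \<Longrightarrow> v i \<bullet> v j = (if i = j then 1 else 0)"
    and v0: "v 0 = (1 / norm2 (map_vec sqrt (degrees n E W))) \<cdot>\<^sub>v map_vec sqrt (degrees n E W)"
    and g_range: "\<And>t. t \<in> {0..2} \<Longrightarrow> g t \<in> {0..1}"
    and g_decreasing: "antimono_on {0..2} g"
    and g_0: "g 0 = 1" and g_2: "g 2 = 0"
    and g_gap: "\<And>i. i < n \<Longrightarrow> 0 < \<omega> i \<Longrightarrow> g (\<omega> i) < 1"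
    and lam_def: "\<And>i. i < n \<Longrightarrow> lam i = g (\<omega> i)"
    and M_carrier: "M \<in> carrier_mat n n" and M_invertible: "invertible_mat M"
    and u0_def: "u0 = mat_inv M *\<^sub>v v 0"
    and x_carrier: "x \<in> carrier_vec n"
  shows "(\<lambda>J. norm_M M (windowed_S w n v lam M J p x
            - nonwindowed_S w n v lam M u0 p x \<cdot>\<^sub>v u0)) \<longlonglongrightarrow> 0"
proof -
  have n: "0 < n"
    using graph by (simp add: weighted_connected_graph_def)
  have dim_deg: "dim_vec (degrees n E W) = n"
    by (simp add: degrees_def)
  have "dim_row (normalized_laplacian n E W) = n"
    by (simp add: normalized_laplacian_def Let_def mat_diag_def)
  then have v: "v i \<in> carrier_vec n" if "i < n" for i
    using eigen[OF that] by (simp add: eigenvector_def)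
  have unit: "v i \<bullet> v i = 1" if "i < n" for i
    using orthonormal[OF that that] by simp
  define b0 where "b0 = 1 / norm2 (map_vec sqrt (degrees n E W))"
  have v0_index: "v 0 $ i = b0 * sqrt (degrees n E W $ i)" if "i < n" for i
    using that by (simp add: v0 b0_def dim_deg)
  \<comment> \<open>If all degrees vanished, \<open>v 0\<close> would be the zero vector and not a
    unit vector. This excludes the single vertex without a loop.\<close>
  have "\<exists>k<n. degrees n E W $ k \<noteq> 0"
  proof (rule ccontr)
    assume "\<not> ?thesis"
    then have "v 0 \<bullet> v 0 = 0"
      using v[OF n] by (auto simp: scalar_prod_def v0_index intro!: sum.neutral)
    with unit[OF n] show False by simp
  qed
  then have dpos: "0 < degrees n E W $ i" if "i < n" for i
    using degrees_pos[OF graph that] by blast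
  note bounds = normalized_laplacian_eigenvalue_bounds[OF graph dpos eigen unit]
  \<comment> \<open>The rescaled \<open>v 0\<close> is the constant \<open>b0\<close>, so all
    differences in its Dirichlet form vanish, and that form equals
    \<open>2 * \<omega> 0\<close>.\<close>
  have omega0: "\<omega> 0 = 0"
  proof -
    have "v 0 $ i / sqrt (degrees n E W $ i) = b0" if "i < n" for i
      using dpos[OF that] by (simp add: v0_index[OF that])
    then show ?thesis
      using eigenvalue_dirichlet_form(1)[OF graph dpos eigen[OF n] unit[OF n]] by simp
  qed
  \<comment> \<open>A second kernel vector would be a multiple of \<open>v 0\<close> and also
    orthogonal to it, contradicting its unit length.\<close>
  have omega_pos: "0 < \<omega> i" if i: "i < n" "i \<noteq> 0" for i
  proof (rule ccontr)
    assume "\<not> ?thesis"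
    with bounds(1)[OF _ i(1) i(1)] have "\<omega> i = 0" by auto
    then have "eigenvector (normalized_laplacian n E W) (v i) 0"
      using eigen[OF i(1)] by simp
    then obtain b where b: "\<And>j. j < n \<Longrightarrow> v i $ j = b * sqrt (degrees n E W $ j)"
      using normalized_laplacian_kernel[OF graph dpos _ unit[OF i(1)]] by blast
    have "b0 \<noteq> 0"
      using unit[OF n] v[OF n] by (auto simp: scalar_prod_def v0_index)
    then have "v i = (b / b0) \<cdot>\<^sub>v v 0"
      using v[OF i(1)] v[OF n] by (intro eq_vecI) (auto simp: b v0_index)
    then have "v i \<bullet> v i = (b / b0) * (v i \<bullet> v 0)"
      using v[OF i(1)] v[OF n] by (metis scalar_prod_smult_right carrier_vecD)
    then show False
      using orthonormal[OF i(1) n] unit[OF i(1)] i(2) by simp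
  qed
  have lam0: "lam 0 = 1"
    using lam_def[OF n] omega0 g_0 by simp
  \<comment> \<open>The eigenvalue bounds place \<open>\<omega> k\<close> in the domain of
    \<open>g\<close>; the strict inequality comes from \<open>g_gap\<close>, applicable because
    \<open>\<omega> k\<close> is positive.\<close>
  have lam_range: "0 \<le> lam k" "lam k < 1" if "k < n" "k \<noteq> 0" for k
    using g_range[of "\<omega> k"] bounds[OF _ that(1) that(1)] g_gap[OF that(1) omega_pos[OF that]]
      lam_def[OF that(1)] by auto
  note inv = mat_inv_inverse[OF M_carrier M_invertible]
  have u0: "u0 \<in> carrier_vec n"
    using inv v[OF n] by (simp add: u0_def mult_mat_vec_carrier[of _ n n])
  \<comment> \<open>Hence the weighted inner product with \<open>u0\<close> is the Euclidean one
    with \<open>v 0\<close>, so the nonwindowed coefficient is the \<open>v 0\<close> component of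
    \<open>M *\<^sub>v y\<close>.\<close>
  have Mu0: "M *\<^sub>v u0 = v 0"
    using M_carrier inv v[OF n] by (simp add: u0_def assoc_mult_mat_vec[of _ n n _ n, symmetric])
  define y where "y = scatter_U w n v lam M p x"
  have y: "y \<in> carrier_vec n"
    unfolding y_def by (rule scatter_U_carrier[OF M_carrier M_invertible x_carrier])
  define e where "e J = M *\<^sub>v (windowed_S w n v lam M J p x
      - nonwindowed_S w n v lam M u0 p x \<cdot>\<^sub>v u0)" for J
  have wS: "windowed_S w n v lam M J p x \<in> carrier_vec n" for J
    using fun_of_K_carrier[OF M_carrier M_invertible] y
    by (simp add: windowed_S_def Phi_def y_def[symmetric] mult_mat_vec_carrier[of _ n n])
  have e_carrier: "e J \<in> carrier_vec n" for J
    using M_carrier wS u0 by (simp add: e_def mult_mat_vec_carrier[of _ n n])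
  \<comment> \<open>The low pass filter equals 1 at \<open>lam 0 = 1\<close> for every
    \<open>J\<close>, so the term \<open>k = 0\<close> of the spectral expansion is exactly what is
    subtracted.\<close>
  have e_index: "e J $ i =
      (\<Sum>k\<in>{..<n} - {0}. low_filter w J (lam k) * (v k \<bullet> (M *\<^sub>v y)) * v k $ i)"
    if i: "i < n" for J i
  proof -
    have "e J = M *\<^sub>v windowed_S w n v lam M J p x - (v 0 \<bullet> (M *\<^sub>v y)) \<cdot>\<^sub>v v 0"
      unfolding e_def using M_carrier wS u0
      by (simp add: mult_minus_distrib_mat_vec[of _ n n] mult_mat_vec[of _ n n] Mu0
          nonwindowed_S_def inner_M_def y_def)
    moreover have "(M *\<^sub>v windowed_S w n v lam M J p x) $ i =
        (\<Sum>k<n. low_filter w J (lam k) * (v k \<bullet> (M *\<^sub>v y)) * v k $ i)"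
      unfolding windowed_S_def Phi_def y_def[symmetric]
      by (rule M_fun_of_K_mult_vec[OF M_carrier M_invertible y v i])
    moreover have "low_filter w J (lam 0) = 1"
      by (cases w) (simp_all add: lam0 low_poly_def)
    ultimately show ?thesis
      using i n v[OF n] by (simp add: sum.remove[of "{..<n}" 0])
  qed
  \<comment> \<open>All remaining \<open>lam k\<close> lie in [0,1), and the sums are finite, so
    coordinatewise convergence suffices for the norm.\<close>
  have "(\<lambda>J. e J $ i) \<longlonglongrightarrow> 0" if i: "i < n" for i
    unfolding e_index[OF i]
    by (intro tendsto_null_sum tendsto_mult_left_zero low_filter_tendsto_0) (auto simp: lam_range)
  then have "(\<lambda>J. sqrt (\<Sum>i<n. e J $ i * e J $ i)) \<longlonglongrightarrow> sqrt 0"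
    by (intro tendsto_real_sqrt tendsto_null_sum tendsto_mult_zero) auto
  moreover have "norm_M M (windowed_S w n v lam M J p x
      - nonwindowed_S w n v lam M u0 p x \<cdot>\<^sub>v u0) = sqrt (\<Sum>i<n. e J $ i * e J $ i)" for J
    using e_carrier[of J]
    by (simp add: norm_M_def norm2_def e_def[symmetric] scalar_prod_def atLeast0LessThan)
  ultimately show ?thesis
    by simp
qed

end
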